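(* Let $A\in\mathbb C^{n\times n}$ be a $\beta$-banded matrix, i.e., $[A]_{ij}=0$ whenever $|i-j|>\beta$, and let $f$ be a scalar function such that $f(A)$ is defined and has exponential decay, i.e., there are constants $C>0$ and $0\le q<1$ such that $|[f(A)]_{ij}|\le C\,q^{\mathrm d(i,j)}$ for all $i,j\in\{1,\dots,n\}$. Let $d$ be a positive integer, consider the distance-$2d$ coloring $\mathrm{col}(i)=(i-1)\bmod(2d\beta+1)+1$, $i=1,\dots,n$, let $V_\ell=\{i:\mathrm{col}(i)=\ell\}$, $v_\ell=\sum_{i\in V_\ell}e_i$ for $\ell=1,\dots,2d\beta+1$, and define $$[f(A)^{[d]}]_{ij}=\begin{cases}[f(A)v_\ell]_i \text{ for } j\in V_\ell & \text{if } \bar{\mathrm d}(i,j)\le d,\\ 0 & \text{if } \bar{\mathrm d}(i,j)>d.\end{cases}$$ Then $$\|f(A)-f(A)^{[d]}\|_1\le 2\beta q\,\frac{2+2d\beta}{1-q}\,\varepsilon,\qquad\text{where } \varepsilon=Cq^d.$$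
   Context: The directed graph $G(A)$ of $A$ has vertices $\{1,\dots,n\}$ and edges $\{(i,j): a_{ij}\ne0,\ i\ne j\}$; $|G(A)|$ is the undirected graph obtained by removing the direction of the edges. $\mathrm d(i,j)$ is the length of a shortest path from $i$ to $j$ in $G(A)$ and $\bar{\mathrm d}(i,j)$ the corresponding distance in $|G(A)|$; both are $\infty$ if there is no path, and $q^\infty:=0$. A distance-$k$ coloring assigns different colors to distinct nodes at distance at most $k$. $e_i$ is the $i$th canonical unit vector. $f(A)$ is the usual matrix function (polynomial in $A$ interpolating $f$ on the spectrum of $A$ in the Hermite sense). $\|\cdot\|_1$ is the maximum absolute column sum norm. *)

theory Defs
  imports
    "HOL-Analysis.Derivative"
    "HOL-Library.Extended_Nat"
    "Graph_Theory.Digraph_Component"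
    "Jordan_Normal_Form.Jordan_Normal_Form"
begin

text \<open>
  Matrices have entries \<open>A $$ (i, j)\<close> with \<open>i, j \<in> {0..<n}\<close>. So the index \<open>i\<close> used here is the
  node \<open>i + 1\<close> of the usual numbering \<open>1, \<dots>, n\<close>.
\<close>

section \<open>Matrix functions\<close>

text \<open>
  All pairs \<open>(k, z)\<close> such that the Jordan form of \<open>A\<close> has a block of size \<open>k\<close> for the eigenvalue
  \<open>z\<close>. Over the complex numbers a Jordan form exists and is unique up to the order of the blocks.
\<close>
definition jordan_blocks :: "complex mat \<Rightarrow> (nat \<times> complex) set" where
  "jordan_blocks A = {b. \<exists>n_as. jordan_nf A n_as \<and> b \<in> set n_as}"

text \<open>
  Existence of the \<open>k\<close>-th complex derivative of \<open>f\<close> at \<open>z\<close>. Since \<^const>\<open>deriv\<close> is total, the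
  existence of the lower derivatives near \<open>z\<close> has to be required explicitly.
\<close>
fun has_nth_deriv :: "nat \<Rightarrow> (complex \<Rightarrow> complex) \<Rightarrow> complex \<Rightarrow> bool" where
  "has_nth_deriv 0 f z \<longleftrightarrow> True"
| "has_nth_deriv (Suc k) f z \<longleftrightarrow>
     eventually (has_nth_deriv k f) (nhds z) \<and> ((deriv ^^ k) f) field_differentiable (at z)"

text \<open>
  An eigenvalue whose largest Jordan block has size \<open>k\<close> contributes the values of the derivatives
  of orders \<open>0, \<dots>, k - 1\<close>; smaller blocks for the same eigenvalue add no further conditions.
\<close>
definition defined_on_spectrum :: "(complex \<Rightarrow> complex) \<Rightarrow> complex mat \<Rightarrow> bool" where
  "defined_on_spectrum f A \<longleftrightarrow> (\<forall>(k, z) \<in> jordan_blocks A. \<forall>j<k. has_nth_deriv j f z)"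

definition hermite_interpolates :: "complex poly \<Rightarrow> (complex \<Rightarrow> complex) \<Rightarrow> complex mat \<Rightarrow> bool" where
  "hermite_interpolates p f A \<longleftrightarrow>
     (\<forall>(k, z) \<in> jordan_blocks A. \<forall>j<k. poly ((pderiv ^^ j) p) z = (deriv ^^ j) f z)"

definition mat_poly :: "complex poly \<Rightarrow> complex mat \<Rightarrow> complex mat" where
  "mat_poly p A = mat (dim_row A) (dim_row A)
     (\<lambda>(i, j). \<Sum>k\<le>degree p. coeff p k * (A ^\<^sub>m k) $$ (i, j))"

text \<open>
  The choice is harmless: Hermite interpolation polynomials exist, and any two of them differ by a
  multiple of the minimal polynomial of \<open>A\<close>, so they take the same value at \<open>A\<close>.
\<close>
definition matfun :: "(complex \<Rightarrow> complex) \<Rightarrow> complex mat \<Rightarrow> complex mat" where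
  "matfun f A = mat_poly (SOME p. hermite_interpolates p f A) A"

section \<open>Graphs and distances\<close>

definition mat_graph :: "complex mat \<Rightarrow> nat pair_pre_digraph" where
  "mat_graph A = \<lparr> pverts = {0..<dim_row A},
     parcs = {(i, j). i < dim_row A \<and> j < dim_row A \<and> A $$ (i, j) \<noteq> 0 \<and> i \<noteq> j} \<rparr>"

text \<open>An undirected graph is represented by the digraph that has both orientations of each edge.\<close>
definition mat_ugraph :: "complex mat \<Rightarrow> nat pair_pre_digraph" where
  "mat_ugraph A = mk_symmetric (with_proj (mat_graph A))"

text \<open>The infimum over the empty set is \<open>\<infinity>\<close>.\<close>
definition gdist :: "'a pair_pre_digraph \<Rightarrow> 'a \<Rightarrow> 'a \<Rightarrow> enat" where
  "gdist G u v = (INF p \<in> {p. pre_digraph.apath (with_proj G) u p v}. enat (length p))"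

definition power_enat :: "real \<Rightarrow> enat \<Rightarrow> real" where
  "power_enat q e = (case e of enat k \<Rightarrow> q ^ k | \<infinity> \<Rightarrow> 0)"

section \<open>Probing\<close>

definition distance_coloring :: "'a pair_pre_digraph \<Rightarrow> nat \<Rightarrow> ('a \<Rightarrow> 'c) \<Rightarrow> bool" where
  "distance_coloring G k c \<longleftrightarrow>
     (\<forall>i\<in>pverts G. \<forall>j\<in>pverts G. i \<noteq> j \<and> gdist G i j \<le> enat k \<longrightarrow> c i \<noteq> c j)"

definition banded :: "nat \<Rightarrow> complex mat \<Rightarrow> bool" where
  "banded \<beta> A \<longleftrightarrow>
     (\<forall>i<dim_row A. \<forall>j<dim_col A. \<bar>int i - int j\<bar> > int \<beta> \<longrightarrow> A $$ (i, j) = 0)"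

text \<open>
  With nodes counted from 1 this is \<open>col i = (i - 1) mod (2 d \<beta> + 1) + 1\<close>; the colors are
  \<open>1, \<dots>, 2 d \<beta> + 1\<close>.
\<close>
definition banded_col :: "nat \<Rightarrow> nat \<Rightarrow> nat \<Rightarrow> nat" where
  "banded_col \<beta> d i = i mod (2 * d * \<beta> + 1) + 1"

definition color_class :: "nat \<Rightarrow> (nat \<Rightarrow> nat) \<Rightarrow> nat \<Rightarrow> nat set" where
  "color_class n c l = {i \<in> {0..<n}. c i = l}"

definition probing_vec :: "nat \<Rightarrow> (nat \<Rightarrow> nat) \<Rightarrow> nat \<Rightarrow> complex Matrix.vec" where
  "probing_vec n c l = finsum_vec TYPE(complex) n (unit_vec n) (color_class n c l)"

text \<open>
  The approximation \<open>F\<^sup>[\<^sup>d\<^sup>]\<close> of \<open>F = f(A)\<close> obtained from a coloring \<open>c\<close>; the color class that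
  contains \<open>j\<close> is the one of color \<open>c j\<close>.
\<close>
definition probing_approx ::
    "complex mat \<Rightarrow> complex mat \<Rightarrow> (nat \<Rightarrow> nat) \<Rightarrow> nat \<Rightarrow> complex mat" where
  "probing_approx A F c d = mat (dim_row A) (dim_row A)
     (\<lambda>(i, j). if gdist (mat_ugraph A) i j \<le> enat d
               then (F *\<^sub>v probing_vec (dim_row A) c (c j)) $ i else 0)"

text \<open>Maximum absolute column sum; only meaningful for matrices with at least one column.\<close>
definition mat_norm1 :: "complex mat \<Rightarrow> real" where
  "mat_norm1 M = Max ((\<lambda>j. \<Sum>i<dim_row M. cmod (M $$ (i, j))) ` {..<dim_col M})"

lemma awalk_banded:
  assumes "A \<in> carrier_mat n n" "banded \<beta> A"
    and "pre_digraph.awalk (with_proj (mat_ugraph A)) u p v"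
  shows "\<bar>int u - int v\<bar> \<le> int \<beta> * int (length p)"
proof -
  have step: "\<bar>int (fst e) - int (snd e)\<bar> \<le> int \<beta>" if "e \<in> parcs (mat_ugraph A)" for e
    using that assms(1,2)
    by (fastforce simp: mat_ugraph_def mat_graph_def parcs_mk_symmetric banded_def abs_minus_commute
        not_less [symmetric])
  have "set p \<subseteq> parcs (mat_ugraph A)" "pcas u p v"
    using assms(3) by (auto simp: pre_digraph.awalk_def cas_with_proj_eq)
  then show ?thesis
  proof (induction p arbitrary: u)
    case (Cons e p)
    then have "\<bar>int (snd e) - int v\<bar> \<le> int \<beta> * int (length p)" "fst e = u"
      by auto
    with step[of e] Cons.prems(1) show ?case
      by (simp add: algebra_simps)
  qed simp
qed

lemma distance_coloring_banded_col:
  assumes A: "A \<in> carrier_mat n n" "banded \<beta> A"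
  shows "distance_coloring (mat_ugraph A) (2 * d) (banded_col \<beta> d)"
  unfolding distance_coloring_def
proof (intro ballI impI, elim conjE)
  fix i j assume ij: "i \<noteq> j" "gdist (mat_ugraph A) i j \<le> enat (2 * d)"
  then have "gdist (mat_ugraph A) i j < enat (Suc (2 * d))"
    by (meson enat_ord_simps(2) le_less_trans lessI)
  then obtain p where p: "pre_digraph.apath (with_proj (mat_ugraph A)) i p j"
      "enat (length p) < enat (Suc (2 * d))"
    unfolding gdist_def by (auto simp: INF_less_iff)
  have "\<bar>int i - int j\<bar> \<le> int \<beta> * int (length p)"
    using awalk_banded[OF A] p(1) by (auto simp: pre_digraph.apath_def)
  also have "\<dots> \<le> int \<beta> * int (2 * d)"
    using p(2) by (intro mult_left_mono) auto
  finally have le: "\<bar>int i - int j\<bar> < int (2 * d * \<beta> + 1)"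
    by (simp add: algebra_simps)
  show "banded_col \<beta> d i \<noteq> banded_col \<beta> d j"
  proof
    assume "banded_col \<beta> d i = banded_col \<beta> d j"
    then have "i mod (2 * d * \<beta> + 1) = j mod (2 * d * \<beta> + 1)"
      by (simp add: banded_col_def)
    then have "int i mod int (2 * d * \<beta> + 1) = int j mod int (2 * d * \<beta> + 1)"
      by (metis zmod_int)
    then have "int (2 * d * \<beta> + 1) dvd int i - int j"
      by (simp only: mod_eq_dvd_iff)
    with le ij(1) show False
      using dvd_imp_le_int[of "int i - int j" "int (2 * d * \<beta> + 1)"] by simp
  qed
qed

end

theory Submission
  imports Defs
begin

text \<open>
  In column \<open>j\<close>, an entry outside the band \<open>\<bar>i - j\<bar> \<le> d \<beta>\<close> is dropped, and one inside it is
  either dropped, although \<open>i\<close> and \<open>j\<close> are at distance at least \<open>d + 1\<close>, or perturbed by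
  entries \<open>(i, k)\<close> with \<open>k \<noteq> j\<close> of the same color. The entries dropped inside the band contribute
  at most \<open>2 d \<beta> C q\<^sup>d\<^sup>+\<^sup>1\<close>. The differences \<open>i - k\<close> of the perturbing entries are pairwise
  distinct and exceed \<open>d \<beta>\<close> in absolute value, as do the differences \<open>i - j\<close> of the entries
  outside the band. Since an entry with difference \<open>x\<close> is at most \<open>C q\<^bsup>\<lceil>\<bar>x\<bar> / \<beta>\<rceil>\<^esup>\<close>, either family
  contributes at most a geometric tail, \<open>2 \<beta> C q\<^sup>d\<^sup>+\<^sup>1 / (1 - q)\<close>.
\<close>

section \<open>Directed and undirected distances\<close>

lemma le_gdistI:
  assumes "\<And>p. pre_digraph.apath (with_proj G) u p v \<Longrightarrow> m \<le> enat (length p)"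
  shows "m \<le> gdist G u v"
  unfolding gdist_def using assms by (intro INF_greatest) simp

lemma gdist_refl: "u \<in> pverts G \<Longrightarrow> gdist G u u = 0"
proof -
  assume u: "u \<in> pverts G"
  have "pre_digraph.apath (with_proj G) u [] u"
    using u by (simp add: pre_digraph.apath_def pre_digraph.awalk_def cas_with_proj_eq
        awalk_verts_with_proj_eq)
  then have "gdist G u u \<le> enat (length ([] :: ('a \<times> 'a) list))"
    unfolding gdist_def by (intro INF_lower) simp
  then show ?thesis
    by (simp add: zero_enat_def [symmetric])
qed

text \<open>Symmetrizing only adds arcs, so directed paths survive. Lower bounds coming from the
  band or from the probing cutoff, both undirected, thus transfer to the directed distance in the
  decay hypothesis.\<close>

lemma gdist_mat_ugraph_le: "gdist (mat_ugraph A) u v \<le> gdist (mat_graph A) u v"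
proof -
  have "pre_digraph.apath (with_proj (mat_ugraph A)) u p v"
    if "pre_digraph.apath (with_proj (mat_graph A)) u p v" for p
    using that
    by (auto simp: pre_digraph.apath_def pre_digraph.awalk_def mat_ugraph_def parcs_mk_symmetric
        cas_with_proj_eq awalk_verts_with_proj_eq)
  then show ?thesis
    unfolding gdist_def by (intro INF_superset_mono) auto
qed

section \<open>Decay in terms of index differences\<close>

lemma power_enat_le:
  assumes "0 \<le> q" "q \<le> 1" "enat m \<le> e"
  shows "power_enat q e \<le> q ^ m"
  using assms by (cases e) (auto simp: power_enat_def power_decreasing)

text \<open>
  This is \<open>q\<^bsup>\<lceil>\<bar>x\<bar> / \<beta>\<rceil>\<^esup>\<close> for \<open>x \<noteq> 0\<close>, where \<open>\<lceil>\<bar>x\<bar> / 0\<rceil>\<close> is read as \<open>\<infinity>\<close>.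
\<close>
definition band_weight :: "nat \<Rightarrow> real \<Rightarrow> int \<Rightarrow> real" where
  "band_weight \<beta> q x = (if \<beta> = 0 then 0 else q ^ Suc ((nat \<bar>x\<bar> - 1) div \<beta>))"

lemma band_weight_nonneg: "0 \<le> q \<Longrightarrow> 0 \<le> band_weight \<beta> q x"
  by (simp add: band_weight_def)

text \<open>Each edge changes the index by at most \<open>\<beta>\<close>, which bounds the length
  of a path from below.\<close>

lemma power_enat_gdist_le_band_weight:
  assumes "A \<in> carrier_mat n n" "banded \<beta> A" "0 \<le> q" "q \<le> 1" "i \<noteq> k"
  shows "power_enat q (gdist (mat_graph A) i k) \<le> band_weight \<beta> q (int i - int k)"
proof -
  have walk: "nat \<bar>int i - int k\<bar> \<le> \<beta> * length p"
    if "pre_digraph.apath (with_proj (mat_ugraph A)) i p k" for p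
    using awalk_banded[OF assms(1,2), of i p k] that
    by (auto simp: pre_digraph.apath_def nat_le_iff)
  show ?thesis
  proof (cases "\<beta> = 0")
    case True
    \<comment> \<open>With \<open>\<beta> = 0\<close> no path joins distinct nodes, so both sides of
      the claim are 0.\<close>
    have "\<infinity> \<le> gdist (mat_ugraph A) i k"
      by (rule le_gdistI) (use walk True assms(5) in fastforce)
    then have "gdist (mat_graph A) i k = \<infinity>"
      using gdist_mat_ugraph_le[of A i k] by simp
    then show ?thesis
      by (simp add: power_enat_def band_weight_def True)
  next
    case False
    have "enat (Suc ((nat \<bar>int i - int k\<bar> - 1) div \<beta>)) \<le> gdist (mat_ugraph A) i k"
    proof (rule le_gdistI)
      fix p assume "pre_digraph.apath (with_proj (mat_ugraph A)) i p k"
      \<comment> \<open>Since \<open>i \<noteq> k\<close>, the truncated subtraction is exact and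
        the inequality strict; one plus the rounded-down quotient is then the ceiling.\<close>
      from walk[OF this] have "nat \<bar>int i - int k\<bar> - 1 < length p * \<beta>"
        using assms(5) by (auto simp: mult.commute)
      then have "(nat \<bar>int i - int k\<bar> - 1) div \<beta> < length p"
        by (rule less_mult_imp_div_less)
      then show "enat (Suc ((nat \<bar>int i - int k\<bar> - 1) div \<beta>)) \<le> enat (length p)"
        by simp
    qed
    then have "enat (Suc ((nat \<bar>int i - int k\<bar> - 1) div \<beta>)) \<le> gdist (mat_graph A) i k"
      using gdist_mat_ugraph_le order_trans by blast
    then show ?thesis
      using power_enat_le[OF assms(3,4)] False by (simp only: band_weight_def if_False)
  qed
qed

text \<open>At most \<open>d\<close> edges move the index by at most \<open>d * \<beta>\<close>.
  Hence probing sets all entries outside the band to 0.\<close>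

lemma less_gdist_of_outside_band:
  assumes "A \<in> carrier_mat n n" "banded \<beta> A" "\<bar>int i - int j\<bar> > int (d * \<beta>)"
  shows "enat d < gdist (mat_ugraph A) i j"
proof -
  have "enat (Suc d) \<le> gdist (mat_ugraph A) i j"
  proof (rule le_gdistI)
    fix p assume "pre_digraph.apath (with_proj (mat_ugraph A)) i p j"
    then have "\<bar>int i - int j\<bar> \<le> int \<beta> * int (length p)"
      using awalk_banded[OF assms(1,2)] by (auto simp: pre_digraph.apath_def)
    with assms(3) have "int (\<beta> * d) < int (\<beta> * length p)"
      by (simp add: mult.commute)
    then have "d < length p"
      by (simp only: of_nat_less_iff mult_less_cancel1)
    then show "enat (Suc d) \<le> enat (length p)"
      by simp
  qed
  then show ?thesis
    by (meson enat_ord_simps(2) less_le_trans lessI)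
qed

section \<open>Geometric tails of band weights\<close>

lemma sum_power_le_geometric_tail:
  fixes q :: real
  assumes "0 \<le> q" "q < 1" "finite L" "L \<subseteq> {m..}"
  shows "(\<Sum>l\<in>L. q ^ l) \<le> q ^ m / (1 - q)"
proof -
  \<comment> \<open>Truncated subtraction of \<open>m\<close> is injective on \<open>L\<close>, as
    no exponent lies below \<open>m\<close>.\<close>
  have "(\<Sum>l\<in>L. q ^ l) = (\<Sum>k\<in>(\<lambda>l. l - m) ` L. q ^ (k + m))"
    using assms(4) by (subst sum.reindex) (fastforce simp: inj_on_def subset_iff eq_diff_iff)+
  also have "\<dots> = q ^ m * (\<Sum>k\<in>(\<lambda>l. l - m) ` L. q ^ k)"
    by (simp add: power_add sum_distrib_left mult.commute)
  also have "(\<Sum>k\<in>(\<lambda>l. l - m) ` L. q ^ k) \<le> (\<Sum>k. q ^ k)"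
    using assms by (intro sum_le_suminf) (auto simp: summable_geometric)
  also have "(\<Sum>k. q ^ k) = 1 / (1 - q)"
    using assms by (simp add: suminf_geometric)
  finally show ?thesis
    using assms(1) by (simp add: mult_left_mono)
qed

text \<open>A level contains at most \<open>\<beta>\<close> consecutive positive integers and their
  negatives. Truncated subtraction would also put 0 into level 0, hence its exclusion.\<close>

lemma card_band_level_le:
  assumes "0 < \<beta>"
  shows "card {x \<in> X. x \<noteq> 0 \<and> (nat \<bar>x\<bar> - 1) div \<beta> = r} \<le> 2 * \<beta>"
proof -
  let ?I = "{int (r * \<beta>)<..int (r * \<beta> + \<beta>)}"
  have "{x \<in> X. x \<noteq> 0 \<and> (nat \<bar>x\<bar> - 1) div \<beta> = r} \<subseteq> ?I \<union> uminus ` ?I"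
  proof
    fix x assume "x \<in> {x \<in> X. x \<noteq> 0 \<and> (nat \<bar>x\<bar> - 1) div \<beta> = r}"
    then have x: "x \<noteq> 0" and r: "(nat \<bar>x\<bar> - 1) div \<beta> = r"
      by auto
    have "r * \<beta> \<le> nat \<bar>x\<bar> - 1" "nat \<bar>x\<bar> - 1 < r * \<beta> + \<beta>"
      using r div_times_less_eq_dividend[of "nat \<bar>x\<bar> - 1" \<beta>]
        dividend_less_div_times[OF assms, of "nat \<bar>x\<bar> - 1"] by auto
    with x have "int (r * \<beta>) < \<bar>x\<bar>" "\<bar>x\<bar> \<le> int (r * \<beta> + \<beta>)"
      by linarith+
    then have "\<bar>x\<bar> \<in> ?I"
      by simp
    then show "x \<in> ?I \<union> uminus ` ?I"
      by (cases "x < 0") (auto intro: image_eqI[of x uminus "- x"])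
  qed
  then have "card {x \<in> X. x \<noteq> 0 \<and> (nat \<bar>x\<bar> - 1) div \<beta> = r} \<le> card (?I \<union> uminus ` ?I)"
    by (intro card_mono) auto
  also have "\<dots> \<le> card ?I + card (uminus ` ?I)"
    by (rule card_Un_le)
  also have "\<dots> \<le> card ?I + card ?I"
    by (intro add_left_mono card_image_le) simp
  finally show ?thesis
    by simp
qed

text \<open>Grouped by exponent, each power of \<open>q\<close> occurs at most
  \<open>2 * \<beta>\<close> times. Distinct integers are what matters, so the bound serves both the
  entries outside the band and the perturbations.\<close>

lemma sum_band_weight_le:
  assumes "0 \<le> q" "q < 1" "finite X" and X: "\<And>x. x \<in> X \<Longrightarrow> \<bar>x\<bar> > int (d * \<beta>)"
  shows "(\<Sum>x\<in>X. band_weight \<beta> q x) \<le> 2 * real \<beta> * (q ^ Suc d / (1 - q))"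
proof (cases "\<beta> = 0")
  case False
  define h where "h x = Suc ((nat \<bar>x\<bar> - 1) div \<beta>)" for x :: int
  have "(\<Sum>x\<in>X. band_weight \<beta> q x) = (\<Sum>l\<in>h ` X. \<Sum>x\<in>{x \<in> X. h x = l}. q ^ h x)"
    using False assms(3) by (subst sum.image_gen[where g = h]) (simp_all add: band_weight_def h_def)
  also have "\<dots> = (\<Sum>l\<in>h ` X. real (card {x \<in> X. h x = l}) * q ^ l)"
    by simp
  also have "\<dots> \<le> (\<Sum>l\<in>h ` X. 2 * real \<beta> * q ^ l)"
  proof (intro sum_mono mult_right_mono)
    fix l
    have "x \<noteq> 0" if "x \<in> X" for x
      using X[OF that] of_nat_0_le_iff[of "d * \<beta>", where ?'a = int] by linarith
    then have "{x \<in> X. h x = l} \<subseteq> {x \<in> X. x \<noteq> 0 \<and> (nat \<bar>x\<bar> - 1) div \<beta> = l - 1}"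
      by (auto simp: h_def)
    then have "card {x \<in> X. h x = l} \<le> card {x \<in> X. x \<noteq> 0 \<and> (nat \<bar>x\<bar> - 1) div \<beta> = l - 1}"
      using assms(3) by (intro card_mono) auto
    also have "\<dots> \<le> 2 * \<beta>"
      using False by (intro card_band_level_le) simp
    finally show "real (card {x \<in> X. h x = l}) \<le> 2 * real \<beta>"
      by linarith
  qed (use assms(1) in simp)
  also have "\<dots> = 2 * real \<beta> * (\<Sum>l\<in>h ` X. q ^ l)"
    by (simp add: sum_distrib_left)
  also have "\<dots> \<le> 2 * real \<beta> * (q ^ Suc d / (1 - q))"
  proof (intro mult_left_mono sum_power_le_geometric_tail)
    show "h ` X \<subseteq> {Suc d..}"
    proof clarsimp
      fix x assume "x \<in> X"
      \<comment> \<open>The strict inequality in \<open>X\<close> makes the exponents start at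
        \<open>Suc d\<close>, which yields the extra factor \<open>q\<close>.\<close>
      then have "d * \<beta> \<le> nat \<bar>x\<bar> - 1"
        using X[of x] by linarith
      then show "Suc d \<le> h x"
        using False by (simp add: h_def less_eq_div_iff_mult_less_eq)
    qed
  qed (use assms in auto)
  finally show ?thesis .
qed (simp add: band_weight_def)

section \<open>Probing vectors and color classes\<close>

lemma mult_probing_vec_index:
  assumes "F \<in> carrier_mat n n" "i < n"
  shows "(F *\<^sub>v probing_vec n c l) $ i = (\<Sum>k\<in>color_class n c l. F $$ (i, k))"
proof -
  have fin: "finite (color_class n c l)"
    by (simp add: color_class_def)
  have ind: "probing_vec n c l $ k = (if k \<in> color_class n c l then 1 else 0)" if "k < n" for k
    using that fin by (simp add: probing_vec_def index_finsum_vec unit_vec_def)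
  have dim: "dim_vec (probing_vec n c l) = n"
    unfolding probing_vec_def by (intro carrier_vecD finsum_vec_closed) auto
  have "(F *\<^sub>v probing_vec n c l) $ i
      = (\<Sum>k\<in>{0..<n}. F $$ (i, k) * (if k \<in> color_class n c l then 1 else 0))"
    using assms dim by (simp add: scalar_prod_def ind)
  also have "\<dots> = (\<Sum>k\<in>{0..<n}. if k \<in> color_class n c l then F $$ (i, k) else 0)"
    by (intro sum.cong) auto
  also have "\<dots> = (\<Sum>k\<in>{0..<n} \<inter> color_class n c l. F $$ (i, k))"
    by (rule sum.inter_restrict [symmetric]) simp
  also have "{0..<n} \<inter> color_class n c l = color_class n c l"
    by (auto simp: color_class_def)
  finally show ?thesis .
qed

lemma same_banded_col_diff:
  assumes "banded_col \<beta> d j = banded_col \<beta> d k"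
  shows "int (2 * d * \<beta> + 1) dvd int j - int k"
proof -
  have "j mod (2 * d * \<beta> + 1) = k mod (2 * d * \<beta> + 1)"
    using assms by (simp add: banded_col_def)
  then have "int j mod int (2 * d * \<beta> + 1) = int k mod int (2 * d * \<beta> + 1)"
    by (metis zmod_int)
  then show ?thesis
    by (simp only: mod_eq_dvd_iff)
qed

section \<open>Error in one column\<close>

lemma probing_approx_column_error:
  fixes \<beta> d n :: nat and C q :: real
  assumes A: "A \<in> carrier_mat n n" "banded \<beta> A" and F: "F \<in> carrier_mat n n"
    and "0 \<le> C" and q: "0 \<le> q" "q < 1"
    and decay: "\<And>i j. i < n \<Longrightarrow> j < n \<Longrightarrow>
           cmod (F $$ (i, j)) \<le> C * power_enat q (gdist (mat_graph A) i j)"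
    and j: "j < n"
  shows "(\<Sum>i<n. cmod ((F - probing_approx A F (banded_col \<beta> d) d) $$ (i, j)))
      \<le> C * (2 * real (d * \<beta>) * q ^ Suc d + 4 * real \<beta> * (q ^ Suc d / (1 - q)))"
proof -
  define E where "E i = (F - probing_approx A F (banded_col \<beta> d) d) $$ (i, j)" for i
  define V where "V = color_class n (banded_col \<beta> d) (banded_col \<beta> d j)"
  \<comment> \<open>\<open>N\<close> cuts by index difference, the approximation by graph distance.
    Nearby indices can be far apart in the graph, hence the two cases in
    \<open>inside\<close>.\<close>
  define N where "N = {i \<in> {..<n}. \<bar>int i - int j\<bar> \<le> int (d * \<beta>)}"
  let ?w = "\<lambda>i k. band_weight \<beta> q (int i - int k)"
  let ?T = "2 * real \<beta> * (q ^ Suc d / (1 - q))"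
  have fin: "finite V" "finite N" and jV: "j \<in> V"
    using j by (auto simp: V_def N_def color_class_def)
  have E: "E i = F $$ (i, j) -
      (if gdist (mat_ugraph A) i j \<le> enat d then \<Sum>k\<in>V. F $$ (i, k) else 0)" if "i < n" for i
    using A F j that by (simp add: E_def V_def probing_approx_def mult_probing_vec_index
        del: index_mult_mat_vec)
  have F_le: "cmod (F $$ (i, k)) \<le> C * ?w i k" if "i < n" "k < n" "i \<noteq> k" for i k
    using decay[OF that(1,2)] power_enat_gdist_le_band_weight[OF A q(1) _ that(3)] q(2) \<open>0 \<le> C\<close>
    by (meson less_imp_le mult_left_mono order_trans)
  have V_far: "k < n" "int (2 * d * \<beta> + 1) dvd int j - int k"
    "\<bar>int j - int k\<bar> \<ge> int (2 * d * \<beta> + 1)" if "k \<in> V - {j}" for k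
  proof -
    show "k < n" and *: "int (2 * d * \<beta> + 1) dvd int j - int k"
      using that same_banded_col_diff[of \<beta> d j k] by (auto simp: V_def color_class_def)
    show "\<bar>int j - int k\<bar> \<ge> int (2 * d * \<beta> + 1)"
      using that dvd_imp_le_int[OF _ *] by auto
  qed
  \<comment> \<open>Triangle inequality: \<open>k\<close> is at least
    \<open>2 * d * \<beta> + 1\<close> away from \<open>j\<close>, and \<open>i\<close> at most
    \<open>d * \<beta>\<close>.\<close>
  have NV_far: "\<bar>int i - int k\<bar> > int (d * \<beta>)" if "i \<in> N" "k \<in> V - {j}" for i k
    using V_far(3)[OF that(2)] that(1) by (simp add: N_def) linarith
  have outside: "cmod (E i) \<le> C * ?w i j" if "i \<in> {..<n} - N" for i
  proof -
    have i: "i < n" "\<bar>int i - int j\<bar> > int (d * \<beta>)"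
      using that by (auto simp: N_def)
    then have "E i = F $$ (i, j)"
      using E[of i] less_gdist_of_outside_band[OF A i(2)] by (simp add: not_le)
    moreover have "i \<noteq> j"
      using i(2) of_nat_0_le_iff[of "d * \<beta>", where ?'a = int] by linarith
    ultimately show ?thesis
      using F_le[of i j] i(1) j by simp
  qed
  have inside: "cmod (E i) \<le> C * ((if i = j then 0 else q ^ Suc d) + (\<Sum>k\<in>V - {j}. ?w i k))"
    if "i \<in> N" for i
  proof -
    have i: "i < n"
      using that by (simp add: N_def)
    have w: "0 \<le> (\<Sum>k\<in>V - {j}. ?w i k)"
      using q(1) by (intro sum_nonneg band_weight_nonneg)
    show ?thesis
    proof (cases "gdist (mat_ugraph A) i j \<le> enat d")
      case True
      \<comment> \<open>The summand for \<open>k = j\<close> in the probed value is the exact entry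
        and cancels.\<close>
      then have "E i = - (\<Sum>k\<in>V - {j}. F $$ (i, k))"
        using E[OF i] fin jV by (simp add: sum.remove)
      then have "cmod (E i) \<le> (\<Sum>k\<in>V - {j}. cmod (F $$ (i, k)))"
        by (simp add: norm_sum)
      also have "\<dots> \<le> (\<Sum>k\<in>V - {j}. C * ?w i k)"
      proof (intro sum_mono F_le i)
        fix k assume k: "k \<in> V - {j}"
        show "k < n" using V_far(1)[OF k] .
        show "i \<noteq> k"
          using NV_far[OF that k] of_nat_0_le_iff[of "d * \<beta>", where ?'a = int] by linarith
      qed
      also have "\<dots> = C * (\<Sum>k\<in>V - {j}. ?w i k)"
        by (simp add: sum_distrib_left)
      also have "\<dots> \<le> C * ((if i = j then 0 else q ^ Suc d) + (\<Sum>k\<in>V - {j}. ?w i k))"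
        using q(1) \<open>0 \<le> C\<close> by (intro mult_left_mono) auto
      finally show ?thesis .
    next
      case False
      \<comment> \<open>The diagonal entry is never dropped, its distance being 0; this justifies
        the 0 in the bound for \<open>i = j\<close>.\<close>
      then have "i \<noteq> j"
        using gdist_refl[of j "mat_ugraph A"] j A(1)
        by (auto simp: mat_ugraph_def mat_graph_def zero_enat_def)
      have "enat (Suc d) \<le> gdist (mat_ugraph A) i j"
        using False by (simp add: Suc_ile_eq)
      then have "enat (Suc d) \<le> gdist (mat_graph A) i j"
        using gdist_mat_ugraph_le order_trans by blast
      then have "power_enat q (gdist (mat_graph A) i j) \<le> q ^ Suc d"
        using q by (intro power_enat_le) auto
      then have "power_enat q (gdist (mat_graph A) i j)
          \<le> (if i = j then 0 else q ^ Suc d) + (\<Sum>k\<in>V - {j}. ?w i k)"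
        using w \<open>i \<noteq> j\<close> by simp
      then have "C * power_enat q (gdist (mat_graph A) i j)
          \<le> C * ((if i = j then 0 else q ^ Suc d) + (\<Sum>k\<in>V - {j}. ?w i k))"
        using \<open>0 \<le> C\<close> by (rule mult_left_mono)
      moreover have "E i = F $$ (i, j)"
        using E[OF i] False by simp
      ultimately show ?thesis
        using decay[OF i j] by simp
    qed
  qed
  have sum_outside: "(\<Sum>i\<in>{..<n} - N. ?w i j) \<le> ?T"
  proof -
    have "(\<Sum>i\<in>{..<n} - N. ?w i j)
        = (\<Sum>x\<in>(\<lambda>i. int i - int j) ` ({..<n} - N). band_weight \<beta> q x)"
      by (subst sum.reindex) (auto simp: inj_on_def)
    also have "\<dots> \<le> ?T"
      using q by (intro sum_band_weight_le) (auto simp: N_def)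
    finally show ?thesis .
  qed
  have sum_perturb: "(\<Sum>i\<in>N. \<Sum>k\<in>V - {j}. ?w i k) \<le> ?T"
  proof -
    \<comment> \<open>Equal differences make \<open>i - i'\<close> equal to \<open>k - k'\<close>, a
      multiple of \<open>2 * d * \<beta> + 1\<close>. Both rows lie in a window of diameter
      \<open>2 * d * \<beta>\<close>, so they coincide.\<close>
    have diff_inj: "i = i' \<and> k = k'"
      if *: "i \<in> N" "k \<in> V - {j}" "i' \<in> N" "k' \<in> V - {j}"
        and eq: "int i - int k = int i' - int k'" for i k i' k'
    proof -
      have "int (2 * d * \<beta> + 1) dvd (int j - int k') - (int j - int k)"
        using * by (intro dvd_diff V_far(2))
      also have "(int j - int k') - (int j - int k) = int i - int i'"
        using eq by simp
      finally have "int (2 * d * \<beta> + 1) dvd int i - int i'" .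
      moreover have "\<bar>int i - int i'\<bar> < int (2 * d * \<beta> + 1)"
        using *(1,3) by (simp add: N_def) linarith
      ultimately have "i = i'"
        using dvd_imp_le_int[of "int i - int i'" "int (2 * d * \<beta> + 1)"] by auto
      with eq show "i = i' \<and> k = k'"
        by simp
    qed
    have inj: "inj_on (\<lambda>x. int (fst x) - int (snd x)) (N \<times> (V - {j}))"
    proof (rule inj_onI)
      fix x y
      assume "x \<in> N \<times> (V - {j})" "y \<in> N \<times> (V - {j})"
        "int (fst x) - int (snd x) = int (fst y) - int (snd y)"
      then show "x = y"
        using diff_inj[of "fst x" "snd x" "fst y" "snd y"]
        by (simp add: mem_Times_iff prod_eq_iff)
    qed
    \<comment> \<open>By injectivity one tail bounds the perturbations of all rows together, rather
      than one tail per row.\<close>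
    have "(\<Sum>i\<in>N. \<Sum>k\<in>V - {j}. ?w i k)
        = (\<Sum>x\<in>(\<lambda>x. int (fst x) - int (snd x)) ` (N \<times> (V - {j})). band_weight \<beta> q x)"
      by (simp add: sum.reindex[OF inj] sum.cartesian_product case_prod_unfold)
    also have "\<dots> \<le> ?T"
      using q fin by (intro sum_band_weight_le) (auto dest: NV_far)
    finally show ?thesis .
  qed
  have sum_dropped: "(\<Sum>i\<in>N. if i = j then 0 else q ^ Suc d) \<le> 2 * real (d * \<beta>) * q ^ Suc d"
  proof -
    \<comment> \<open>At most \<open>d * \<beta>\<close> rows on either side of \<open>j\<close>;
      truncation at 0 only shortens the left interval.\<close>
    have "N - {j} \<subseteq> {j - d * \<beta>..<j} \<union> {j<..j + d * \<beta>}"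
    proof
      fix i assume "i \<in> N - {j}"
      then have "i \<noteq> j" "\<bar>int i - int j\<bar> \<le> int (d * \<beta>)"
        by (auto simp: N_def)
      then have "j - d * \<beta> \<le> i \<and> i < j \<or> j < i \<and> i \<le> j + d * \<beta>"
        by linarith
      then show "i \<in> {j - d * \<beta>..<j} \<union> {j<..j + d * \<beta>}"
        by simp
    qed
    then have "card (N - {j}) \<le> card ({j - d * \<beta>..<j} \<union> {j<..j + d * \<beta>})"
      by (intro card_mono) auto
    also have "\<dots> \<le> card {j - d * \<beta>..<j} + card {j<..j + d * \<beta>}"
      by (rule card_Un_le)
    also have "\<dots> \<le> 2 * (d * \<beta>)"
      by simp
    finally have card: "real (card (N - {j})) \<le> 2 * real (d * \<beta>)"
      by linarith
    have "(\<Sum>i\<in>N. if i = j then 0 else q ^ Suc d) = (\<Sum>i\<in>N - {j}. q ^ Suc d)"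
      using fin by (intro sum.mono_neutral_cong_right) auto
    also have "\<dots> = real (card (N - {j})) * q ^ Suc d"
      by simp
    also have "\<dots> \<le> 2 * real (d * \<beta>) * q ^ Suc d"
      using card q(1) by (intro mult_right_mono) auto
    finally show ?thesis .
  qed
  have "(\<Sum>i<n. cmod (E i)) = (\<Sum>i\<in>{..<n} - N. cmod (E i)) + (\<Sum>i\<in>N. cmod (E i))"
    by (intro sum.subset_diff) (auto simp: N_def)
  also have "\<dots> \<le> (\<Sum>i\<in>{..<n} - N. C * ?w i j)
      + (\<Sum>i\<in>N. C * ((if i = j then 0 else q ^ Suc d) + (\<Sum>k\<in>V - {j}. ?w i k)))"
    using outside inside by (intro add_mono sum_mono)
  also have "\<dots> = C * ((\<Sum>i\<in>{..<n} - N. ?w i j)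
      + ((\<Sum>i\<in>N. if i = j then 0 else q ^ Suc d) + (\<Sum>i\<in>N. \<Sum>k\<in>V - {j}. ?w i k)))"
    by (simp only: sum_distrib_left [symmetric] sum.distrib distrib_left [symmetric])
  also have "\<dots> \<le> C * (?T + (2 * real (d * \<beta>) * q ^ Suc d + ?T))"
    using \<open>0 \<le> C\<close> sum_outside sum_perturb sum_dropped by (intro mult_left_mono add_mono)
  also have "\<dots> = C * (2 * real (d * \<beta>) * q ^ Suc d + 4 * real \<beta> * (q ^ Suc d / (1 - q)))"
    by simp
  finally show ?thesis
    by (simp only: E_def)
qed

section \<open>From columns to the norm\<close>

theorem corollary3p8:
  fixes A :: "complex mat" and f :: "complex \<Rightarrow> complex"
    and n \<beta> d :: nat and C q :: real
  assumes "0 < n" and "A \<in> carrier_mat n n"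
    and "banded \<beta> A"
    and "defined_on_spectrum f A"
    and "0 < C" and "0 \<le> q" and "q < 1"
    and "\<And>i j. i < n \<Longrightarrow> j < n \<Longrightarrow>
           cmod (matfun f A $$ (i, j)) \<le> C * power_enat q (gdist (mat_graph A) i j)"
    and "0 < d"
  shows "mat_norm1 (matfun f A - probing_approx A (matfun f A) (banded_col \<beta> d) d)
           \<le> 2 * real \<beta> * q * ((2 + 2 * real d * real \<beta>) / (1 - q)) * (C * q ^ d)"
proof -
  let ?F = "matfun f A"
  have dims: "?F \<in> carrier_mat n n"
    using assms(2) by (auto simp: matfun_def mat_poly_def)
  have dimE: "dim_row (?F - probing_approx A ?F (banded_col \<beta> d) d) = n"
    "dim_col (?F - probing_approx A ?F (banded_col \<beta> d) d) = n"
    using assms(2) by (auto simp: probing_approx_def)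
  \<comment> \<open>The column bound is sharper than the claim: the dropped entries,
    \<open>2 * d * \<beta>\<close> in number, must fit under the summand
    \<open>4 * d * \<beta> * \<beta> / (1 - q)\<close> of the target. This holds trivially for
    \<open>\<beta> = 0\<close>, and otherwise by \<open>\<beta> \<ge> 1\<close> and
    \<open>1 - q \<le> 1\<close>.\<close>
  have "real (d * \<beta>) \<le> 2 * real (d * \<beta>) * real \<beta>"
    by (cases \<beta>) (auto simp: algebra_simps)
  moreover have "q ^ Suc d \<le> q ^ Suc d / (1 - q)"
    using assms(6,7) by (simp add: field_simps)
  ultimately have "real (d * \<beta>) * q ^ Suc d \<le> 2 * real (d * \<beta>) * real \<beta> * (q ^ Suc d / (1 - q))"
    using assms(6) by (intro mult_mono) auto
  then have "2 * real (d * \<beta>) * q ^ Suc d + 4 * real \<beta> * (q ^ Suc d / (1 - q))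
      \<le> 4 * real (d * \<beta>) * real \<beta> * (q ^ Suc d / (1 - q)) + 4 * real \<beta> * (q ^ Suc d / (1 - q))"
    by simp
  also have "\<dots> = 2 * real \<beta> * q * ((2 + 2 * real d * real \<beta>) / (1 - q)) * q ^ d"
    by (simp add: algebra_simps add_divide_distrib)
  finally have bound: "C * (2 * real (d * \<beta>) * q ^ Suc d + 4 * real \<beta> * (q ^ Suc d / (1 - q)))
      \<le> 2 * real \<beta> * q * ((2 + 2 * real d * real \<beta>) / (1 - q)) * (C * q ^ d)"
    using mult_left_mono[OF _ less_imp_le[OF assms(5)]] by (fastforce simp: mult_ac)
  show ?thesis
    unfolding mat_norm1_def dimE
  \<comment> \<open>The maximum runs over a nonempty set of columns because
    \<open>0 < n\<close>.\<close>
  proof (rule Max.boundedI)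
    show "(\<lambda>j. \<Sum>i<n. cmod ((?F - probing_approx A ?F (banded_col \<beta> d) d) $$ (i, j))) ` {..<n} \<noteq> {}"
      using assms(1) by auto
  next
    fix s
    assume "s \<in> (\<lambda>j. \<Sum>i<n. cmod ((?F - probing_approx A ?F (banded_col \<beta> d) d) $$ (i, j))) ` {..<n}"
    then obtain j where j: "j < n"
        "s = (\<Sum>i<n. cmod ((?F - probing_approx A ?F (banded_col \<beta> d) d) $$ (i, j)))"
      by auto
    show "s \<le> 2 * real \<beta> * q * ((2 + 2 * real d * real \<beta>) / (1 - q)) * (C * q ^ d)"
      unfolding j(2)
      by (rule order_trans[OF probing_approx_column_error[OF assms(2,3) dims _ assms(6,7,8) j(1)]
            bound])
        (use assms(5) in simp_all)
  qed simp
qed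

end
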